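(* Let $(a(n))$ be the almost Golomb sequence of order $2$. For every $n\ge 4$, $$a(n+1)=1+a\Bigl(n+1-a\bigl(a(n)+1\bigr)+a\bigl(a(n)-1\bigr)\Bigr).$$
   Context: The almost Golomb sequence of order $2$ is the nondecreasing sequence of positive integers $(a(n))_{n\ge 1}$, extended by $a(0)=0$, such that $a\bigl(a(n)+a(n-1)\bigr)=n$ for every $n\ge 1$ and such that, for every $n\ge 2$, no integer $m$ with $a(n-1)\le m<a(n)$ satisfies $a\bigl(m+a(n-1)\bigr)=n$. It begins $1,2,2,3,4,4,5,6,7,7,8,8,9,\ldots$
   Formalization: The condition that no m with a(n-1) ≤ m < a(n) satisfies a(m+a(n-1)) = n is required only for n ≥ 3, since at n = 2 the displayed sequence itself violates it (m = 1 gives a(2) = 2) and no sequence meets it. *)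

theory Defs
  imports Main
begin

text \<open>
  The sequence is a function on \<^typ>\<open>nat\<close>, so \<open>n - 1\<close> below is only used for \<open>n \<ge> 1\<close>.

  The minimality clause starts at \<open>n = 3\<close>. Demanded at \<open>n = 2\<close> as well, it is violated by the
  sequence \<open>1, 2, 2, 3, 4, 4, \<dots>\<close> itself (with \<open>m = 1\<close>, since \<open>a (1 + a 1) = a 2 = 2\<close>), and no
  sequence whatsoever meets it together with the other clauses
  (\<open>no_minimality_at_2\<close>). Starting at \<open>n = 3\<close>, the clauses determine exactly one sequence
  (\<open>ex1_almost_golomb2\<close>), and it has the intended initial values (\<open>almost_golomb2_initial\<close>).
\<close>

definition almost_golomb2 :: "(nat \<Rightarrow> nat) \<Rightarrow> bool" where
  "almost_golomb2 a \<longleftrightarrow>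
     a 0 = 0 \<and>
     (\<forall>n\<ge>1. a n > 0) \<and>
     (\<forall>i j. 1 \<le> i \<longrightarrow> i \<le> j \<longrightarrow> a i \<le> a j) \<and>
     (\<forall>n\<ge>1. a (a n + a (n - 1)) = n) \<and>
     (\<forall>n\<ge>3. \<not> (\<exists>m. a (n - 1) \<le> m \<and> m < a n \<and> a (m + a (n - 1)) = n))"

lemma no_minimality_at_2:
  fixes a :: "nat \<Rightarrow> nat"
  assumes "a 0 = 0"
    and "\<forall>n\<ge>1. a n > 0"
    and mono: "\<forall>i j. 1 \<le> i \<longrightarrow> i \<le> j \<longrightarrow> a i \<le> a j"
    and eq: "\<forall>n\<ge>1. a (a n + a (n - 1)) = n"
  shows "\<exists>m. a (2 - 1) \<le> m \<and> m < a 2 \<and> a (m + a (2 - 1)) = 2"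
proof -
  have p1: "a 1 > 0" and p2: "a 2 > 0" using assms(2) by auto
  have "a (a 1) = 1" using eq assms(1) by (metis add_0_right diff_self_eq_0 le_refl)
  moreover have "a 1 \<le> a (a 1)" using mono p1 by auto
  ultimately have a1: "a 1 = 1" using p1 by linarith
  have e2: "a (a 2 + 1) = 2" using eq[rule_format, of 2] a1 by simp
  moreover have "a 2 \<le> a (a 2 + 1)" using mono p2 by auto
  ultimately have "a 2 = 1 \<or> a 2 = 2" using p2 by linarith
  with e2 have "a 2 = 2" by (auto simp: numeral_2_eq_2)
  then show ?thesis using a1 by (intro exI[of _ 1]) (simp add: numeral_2_eq_2)
qed

context
  fixes a :: "nat \<Rightarrow> nat"
  assumes ag: "almost_golomb2 a"
begin

lemma almost_golomb2_mono: "i \<le> j \<Longrightarrow> a i \<le> a j"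
  using ag unfolding almost_golomb2_def by (cases i) auto

lemma almost_golomb2_eq: "n \<ge> 1 \<Longrightarrow> a (a n + a (n - 1)) = n"
  using ag unfolding almost_golomb2_def by blast

lemma almost_golomb2_step: "a (Suc n) \<le> Suc (a n)"
proof (rule ccontr)
  assume *: "\<not> ?thesis"
  define p where "p = a (Suc (a n)) + a (a n)"
  have "a p = Suc (a n)" using almost_golomb2_eq[of "Suc (a n)"] by (simp add: p_def)
  moreover have "p \<le> n \<or> Suc n \<le> p" by linarith
  ultimately show False
    using * almost_golomb2_mono[of p n] almost_golomb2_mono[of "Suc n" p] by auto
qed

lemma almost_golomb2_le: "a n \<le> n"
proof (induction n)
  case 0
  then show ?case using ag by (simp add: almost_golomb2_def)
next
  case (Suc n)
  then show ?case using almost_golomb2_step[of n] by linarith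
qed

text \<open>The natural-number subtraction \<open>n + 1 - a (a n + 1)\<close> does not truncate.\<close>

lemma almost_golomb2_le_Suc: "a (a n + 1) \<le> n + 1"
  using almost_golomb2_le[of n] almost_golomb2_le[of "a n + 1"] by linarith

lemma almost_golomb2_start: "a 0 = 0" "a 1 = 1" "a 2 = 2" "a 3 = 2" "a 4 = 3"
proof -
  have pos: "a n > 0" if "n \<ge> 1" for n using ag that by (auto simp: almost_golomb2_def)
  show a0: "a 0 = 0" using ag by (simp add: almost_golomb2_def)
  show a1: "a 1 = 1" using pos[of 1] almost_golomb2_le[of 1] by simp
  have e2: "a (a 2 + 1) = 2" using almost_golomb2_eq[of 2] a1 by simp
  moreover have "a 2 = 1 \<or> a 2 = 2" using pos[of 2] almost_golomb2_le[of 2] by auto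
  ultimately show a2: "a 2 = 2" by (auto simp: numeral_2_eq_2)
  show a3: "a 3 = 2" using e2 a2 by simp
  show "a 4 = 3" using almost_golomb2_eq[of 3] a2 a3 by simp
qed

lemma almost_golomb2_no3:
  assumes "n \<ge> 1" shows "a n < a (n + 2)"
proof (rule ccontr)
  assume *: "\<not> ?thesis"
  then have "a (n + 2) = a n" "a (n + 1) = a n"
    using almost_golomb2_mono[of n "n + 1"] almost_golomb2_mono[of "n + 1" "n + 2"] by auto
  then show False
    using almost_golomb2_eq[of "n + 1"] almost_golomb2_eq[of "n + 2"] by simp
qed

lemma almost_golomb2_first:
  assumes "n \<ge> 3" shows "a (a n + a (n - 1) - 1) < n"
proof (cases "a n = a (n - 1)")
  case True
  obtain k where k: "n = k + 2" "k \<ge> 1" using assms by (intro that[of "n - 2"]) auto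
  have "a k < a (k + 1)" using almost_golomb2_no3[OF k(2)] True k by simp
  then have "a (k + 1) = a k + 1" using almost_golomb2_step[of k] by simp
  moreover have "a (a (k + 1) + a k) = k + 1" using almost_golomb2_eq[of "k + 1"] by simp
  ultimately show ?thesis using True k by simp
next
  case False
  then have l: "a (n - 1) < a n"
    using almost_golomb2_mono[of "n - 1" n] by (simp add: le_neq_implies_less)
  then have "a ((a n - 1) + a (n - 1)) \<noteq> n"
    using ag assms unfolding almost_golomb2_def
    by (metis One_nat_def Suc_pred diff_Suc_less gr_implies_not0 less_Suc_eq_le not_gr_zero)
  moreover have "a (a n + a (n - 1) - 1) \<le> n"
    using almost_golomb2_mono[of "a n + a (n - 1) - 1" "a n + a (n - 1)"]
      almost_golomb2_eq[of n] assms by simp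
  ultimately show ?thesis using l by simp
qed

lemma almost_golomb2_rec:
  assumes "k \<ge> 2"
  shows "a (Suc k) = (if a (Suc (a k)) + a (a k) = Suc k then Suc (a k) else a k)"
proof -
  have a2: "a k \<ge> 2" using almost_golomb2_mono[OF assms] almost_golomb2_start by simp
  define p where "p = a (Suc (a k)) + a (a k)"
  have ap: "a p = Suc (a k)" using almost_golomb2_eq[of "Suc (a k)"] by (simp add: p_def)
  have fp: "a (p - 1) < Suc (a k)"
    using almost_golomb2_first[of "Suc (a k)"] a2 by (simp add: p_def)
  show ?thesis
  proof (cases "p = Suc k")
    case True
    then show ?thesis using ap by (simp add: p_def)
  next
    case False
    have "k < p" using ap almost_golomb2_mono[of p k] by (cases "p \<le> k") auto
    then have "a (Suc k) \<le> a (p - 1)" using False by (intro almost_golomb2_mono) simp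
    then have "a (Suc k) = a k" using fp almost_golomb2_mono[of k "Suc k"] by simp
    then show ?thesis using False by (simp add: p_def)
  qed
qed

lemma almost_golomb2_initial:
  "map a [1..<14] = [1, 2, 2, 3, 4, 4, 5, 6, 7, 7, 8, 8, 9]"
proof -
  note s = almost_golomb2_start
  note r = almost_golomb2_rec
  have 5: "a 5 = 4" using r[of 4] s by (simp add: numeral_eq_Suc)
  have 6: "a 6 = 4" using r[of 5] s 5 by (simp add: numeral_eq_Suc)
  have 7: "a 7 = 5" using r[of 6] s 5 6 by (simp add: numeral_eq_Suc)
  have 8: "a 8 = 6" using r[of 7] s 5 6 7 by (simp add: numeral_eq_Suc)
  have 9: "a 9 = 7" using r[of 8] s 5 6 7 8 by (simp add: numeral_eq_Suc)
  have 10: "a 10 = 7" using r[of 9] s 5 6 7 8 9 by (simp add: numeral_eq_Suc)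
  have 11: "a 11 = 8" using r[of 10] s 5 6 7 8 9 10 by (simp add: numeral_eq_Suc)
  have 12: "a 12 = 8" using r[of 11] s 5 6 7 8 9 10 11 by (simp add: numeral_eq_Suc)
  have 13: "a 13 = 9" using r[of 12] s 5 6 7 8 9 10 11 12 by (simp add: numeral_eq_Suc)
  show ?thesis using s 5 6 7 8 9 10 11 12 13 by (simp add: upt_rec numeral_eq_Suc)
qed

lemma almost_golomb2_lt:
  assumes "k \<ge> 3" shows "a k < k"
  using assms
proof (induction k rule: nat_induct_at_least)
  case base
  then show ?case using almost_golomb2_start by simp
next
  case (Suc k)
  then show ?case using almost_golomb2_step[of k] by linarith
qed

end

lemma almost_golomb2_unique:
  assumes a: "almost_golomb2 a" and b: "almost_golomb2 b"
  shows "a = b"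
proof
  fix n show "a n = b n"
  proof (induction n rule: less_induct)
    case (less n)
    show ?case
    proof (cases "n \<le> 4")
      case True
      then have "n = 0 \<or> n = 1 \<or> n = 2 \<or> n = 3 \<or> n = 4" by linarith
      then show ?thesis using almost_golomb2_start[OF a] almost_golomb2_start[OF b] by metis
    next
      case False
      then obtain k where k: "n = Suc k" "k \<ge> 4" by (cases n) auto
      have e: "a k = b k" using less k by simp
      have "b k < k" using almost_golomb2_lt[OF b, of k] k by simp
      then have "a (b k) = b (b k)" "a (Suc (b k)) = b (Suc (b k))" using less k by auto
      then show ?thesis
        using almost_golomb2_rec[OF a, of k] almost_golomb2_rec[OF b, of k] e k by simp
    qed
  qed
qed

text \<open>The guards \<open>< k\<close> only serve termination.\<close>

function ag2 :: "nat \<Rightarrow> nat" where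
  "ag2 k = (if k \<le> 2 then k else if k = 3 then 2 else if k = 4 then 3 else
     (let j = ag2 (k - 1) in
        if j + 1 < k then (if ag2 (j + 1) + ag2 j = k then j + 1 else j) else j))"
  by pat_completeness auto
termination by (relation "measure id") auto

declare ag2.simps [simp del]

lemma ag2_start: "ag2 0 = 0" "ag2 (Suc 0) = 1" "ag2 2 = 2" "ag2 3 = 2" "ag2 4 = 3"
  by (simp_all add: ag2.simps)

lemma ag2_step0: "ag2 k \<le> ag2 (Suc k) \<and> ag2 (Suc k) \<le> Suc (ag2 k)"
proof -
  consider "k = 0" | "k = 1" | "k = 2" | "k = 3" | "k \<ge> 4" by linarith
  then show ?thesis
  proof cases
    case 5
    then show ?thesis using ag2.simps[of "Suc k"] by (auto simp: Let_def)
  qed (use ag2_start in \<open>auto simp: numeral_eq_Suc\<close>)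
qed

lemma ag2_mono: "i \<le> j \<Longrightarrow> ag2 i \<le> ag2 j"
  by (rule lift_Suc_mono_le) (use ag2_step0 in auto)

lemma ag2_lt: "k \<ge> 3 \<Longrightarrow> ag2 k < k"
proof (induction k rule: nat_induct_at_least)
  case base then show ?case by (simp add: ag2_start)
next
  case (Suc k) then show ?case using ag2_step0[of k] by linarith
qed

lemma ag2_rec:
  "k \<ge> 4 \<Longrightarrow> ag2 (Suc k) = (if ag2 (Suc (ag2 k)) + ag2 (ag2 k) = Suc k then Suc (ag2 k) else ag2 k)"
  using ag2_lt[of k] ag2.simps[of "Suc k"] by (simp add: Let_def)

lemma ag2_vals: "ag2 5 = 4" "ag2 6 = 4" "ag2 7 = 5"
proof -
  note s = ag2_start
  show 5: "ag2 5 = 4" using ag2_rec[of 4] s by (simp add: numeral_eq_Suc)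
  show 6: "ag2 6 = 4" using ag2_rec[of 5] s 5 by (simp add: numeral_eq_Suc)
  show "ag2 7 = 5" using ag2_rec[of 6] s 5 6 by (simp add: numeral_eq_Suc)
qed

lemma ag2_lt2: "k \<ge> 6 \<Longrightarrow> ag2 k + 2 \<le> k"
proof (induction k rule: nat_induct_at_least)
  case base then show ?case by (simp add: ag2_vals)
next
  case (Suc k) then show ?case using ag2_step0[of k] by linarith
qed

lemma ag2_inv:
  assumes "k \<ge> 4"
  shows "ag2 (ag2 k) + ag2 (ag2 k - 1) \<le> k \<and> k < ag2 (Suc (ag2 k)) + ag2 (ag2 k)"
  using assms
proof (induction k rule: less_induct)
  case (less k)
  consider "k = 4" | "k = 5" | "k = 6" | "k \<ge> 7" using less.prems by linarith
  then show ?case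
  proof cases
    case 4
    then obtain l where l: "k = Suc l" "l \<ge> 6" by (cases k) auto
    define j where "j = ag2 l"
    have I: "ag2 j + ag2 (j - 1) \<le> l" "l < ag2 (Suc j) + ag2 j"
      using less.IH[of l] l by (auto simp: j_def)
    have j4: "j \<ge> 4" using ag2_mono[of 6 l] l ag2_vals by (simp add: j_def)
    have jl: "j + 2 \<le> l" using ag2_lt2[of l] l by (simp add: j_def)
    show ?thesis
    proof (cases "ag2 (Suc j) + ag2 j = Suc l")
      case True
      then have e: "ag2 k = Suc j" using ag2_rec[of l] l by (simp add: j_def)
      have "ag2 j \<noteq> ag2 (j + 2)"
      proof
        assume eq: "ag2 j = ag2 (j + 2)"
        define i where "i = ag2 j"
        have i3: "i \<ge> 3" using ag2_mono[OF j4] ag2_start by (simp add: i_def)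
        have 1: "ag2 i + ag2 (i - 1) \<le> j" using less.IH[of j] j4 jl l by (simp add: i_def)
        have 2: "j + 2 < ag2 (Suc i) + ag2 i"
          using less.IH[of "j + 2"] j4 jl l eq by (simp add: i_def)
        have "ag2 (Suc i) \<le> ag2 (i - 1) + 2"
          using ag2_step0[of i] ag2_step0[of "i - 1"] i3 by simp
        then show False using 1 2 by linarith
      qed
      moreover have "ag2 j \<le> ag2 (j + 2)" by (rule ag2_mono) simp
      ultimately have "ag2 j < ag2 (j + 2)" by simp
      then show ?thesis using e True l by simp
    next
      case False
      then have "ag2 k = j" using ag2_rec[of l] l by (simp add: j_def)
      then show ?thesis using I False l by simp
    qed
  qed (use ag2_start ag2_vals in \<open>simp_all add: numeral_eq_Suc\<close>)
qed

lemma ag2_mono_f: "ag2 n + ag2 (n - 1) \<le> ag2 (n + d) + ag2 (n + d - 1)"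
  by (intro add_mono ag2_mono) auto

lemma ag2_val_iff:
  assumes "k \<ge> 4" "n \<ge> 1"
  shows "ag2 k \<ge> n \<longleftrightarrow> ag2 n + ag2 (n - 1) \<le> k"
proof
  assume "n \<le> ag2 k"
  then show "ag2 n + ag2 (n - 1) \<le> k"
    using ag2_inv[OF assms(1)] ag2_mono_f[of n "ag2 k - n"] by simp
next
  assume *: "ag2 n + ag2 (n - 1) \<le> k"
  show "n \<le> ag2 k"
  proof (rule ccontr)
    assume "\<not> n \<le> ag2 k"
    then have "ag2 (Suc (ag2 k)) + ag2 (ag2 k) \<le> ag2 n + ag2 (n - 1)"
      using ag2_mono_f[of "Suc (ag2 k)" "n - Suc (ag2 k)"] by simp
    then show False using * ag2_inv[OF assms(1)] by linarith
  qed
qed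

lemma ag2_surj_strict:
  assumes "n \<ge> 3" shows "ag2 n + ag2 (n - 1) < ag2 (Suc n) + ag2 n"
proof (cases "n = 3")
  case True
  then show ?thesis using ag2_start by (simp add: numeral_eq_Suc)
next
  case False
  define k where "k = n - 1"
  have n: "n = Suc k" "k \<ge> 3" using assms False by (auto simp: k_def)
  have "ag2 k < ag2 (k + 2)"
  proof (cases "k = 3")
    case True then show ?thesis using ag2_start ag2_vals by simp
  next
    case False
    then have k4: "k \<ge> 4" using n by simp
    define i where "i = ag2 k"
    have i3: "i \<ge> 3" using ag2_mono[OF k4] ag2_start by (simp add: i_def)
    have 1: "ag2 i + ag2 (i - 1) \<le> k" using ag2_inv[OF k4] by (simp add: i_def)
    have "ag2 (Suc i) \<le> ag2 (i - 1) + 2"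
      using ag2_step0[of i] ag2_step0[of "i - 1"] i3 by simp
    then have "Suc i \<le> ag2 (k + 2)"
      using 1 k4 by (subst ag2_val_iff) auto
    then show ?thesis by (simp add: i_def)
  qed
  then show ?thesis using n by simp
qed

lemma almost_golomb2_ag2: "almost_golomb2 ag2"
proof -
  have f4: "ag2 n + ag2 (n - 1) \<ge> 4" if "n \<ge> 3" for n
    using ag2_mono[OF that] ag2_mono[of 2 "n - 1"] that ag2_start by linarith
  have eq: "ag2 (ag2 n + ag2 (n - 1)) = n" if "n \<ge> 1" for n
  proof (cases "n \<ge> 3")
    case True
    define p where "p = ag2 n + ag2 (n - 1)"
    have p4: "p \<ge> 4" using f4[OF True] by (simp add: p_def)
    have "ag2 p \<ge> n" using ag2_val_iff[OF p4, of n] that by (simp add: p_def)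
    moreover have "\<not> ag2 p \<ge> Suc n"
      using ag2_val_iff[OF p4, of "Suc n"] ag2_surj_strict[OF True] by (simp add: p_def)
    ultimately show ?thesis by (simp add: p_def)
  next
    case False
    then have "n = 1 \<or> n = 2" using that by linarith
    then show ?thesis using ag2_start by (auto simp: numeral_eq_Suc)
  qed
  have min: "ag2 (m + ag2 (n - 1)) \<noteq> n" if "n \<ge> 3" "ag2 (n - 1) \<le> m" "m < ag2 n" for n m
  proof -
    have "ag2 (n - 1) \<ge> 2" using ag2_mono[of 2 "n - 1"] that ag2_start by simp
    then have "m + ag2 (n - 1) \<ge> 4" using that by linarith
    then have "\<not> ag2 (m + ag2 (n - 1)) \<ge> n" using ag2_val_iff[of "m + ag2 (n - 1)" n] that by simp
    then show ?thesis by simp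
  qed
  have pos: "ag2 n > 0" if "n \<ge> 1" for n using ag2_mono[OF that] ag2_start by simp
  show ?thesis
    unfolding almost_golomb2_def using ag2_start(1) pos ag2_mono eq min by blast
qed

lemma ex1_almost_golomb2: "\<exists>!a. almost_golomb2 a"
  using almost_golomb2_ag2 almost_golomb2_unique by blast

end

theory Submission
  imports Defs
begin

text \<open>
  Write \<open>j = a n\<close> and \<open>p k = a k + a (k - 1)\<close>, the first position at which the value \<open>k \<ge> 3\<close>
  occurs. The difference \<open>a (j + 1) - a (j - 1)\<close> subtracted in the recurrence is
  \<open>p (j + 1) - p j\<close>, the length of the block of indices with value \<open>j\<close>, and \<open>n\<close> lies in that
  block. If \<open>n + 1\<close> starts the block of \<open>j + 1\<close>, shifting it back by this length sends it to the
  start of the block of \<open>j\<close>. Otherwise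
  \<open>n\<close> and \<open>n + 1\<close> both have value \<open>j\<close>. As the sequence grows by at most one per step, the block
  has length at most two, so \<open>n\<close> is its start and \<open>n + 1\<close> is sent to the last index with value
  \<open>j - 1\<close>. In both cases the value drops by exactly one.
\<close>

text \<open>
  The index \<open>a k + a (k - 1)\<close> carries the value \<open>k\<close> and its predecessor a smaller one, so by
  monotonicity the indices with value \<open>k \<ge> 3\<close> run from \<open>a k + a (k - 1)\<close> up to, but not
  including, \<open>a (k + 1) + a k\<close>. Stated for \<open>k = a n\<close>.
\<close>

lemma almost_golomb2_block:
  assumes ag: "almost_golomb2 a" and "a n \<ge> 3"
  shows "a (a n) + a (a n - 1) \<le> n" and "n < a (a n + 1) + a (a n)"
proof -
  show "a (a n) + a (a n - 1) \<le> n"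
  proof (rule ccontr)
    assume "\<not> ?thesis"
    then have "a n \<le> a (a (a n) + a (a n - 1) - 1)"
      by (intro almost_golomb2_mono[OF ag]) simp
    then show False using almost_golomb2_first[OF ag assms(2)] by simp
  qed
  show "n < a (a n + 1) + a (a n)"
  proof (rule ccontr)
    assume "\<not> ?thesis"
    then have "a (a (a n + 1) + a (a n)) \<le> a n"
      by (intro almost_golomb2_mono[OF ag]) simp
    then show False using almost_golomb2_eq[OF ag, of "a n + 1"] by simp
  qed
qed

theorem proposition3p5:
  fixes a :: "nat \<Rightarrow> nat" and n :: nat
  assumes "almost_golomb2 a"
    and "n \<ge> 4"
  shows "a (n + 1) = 1 + a (n + 1 - a (a n + 1) + a (a n - 1))"
proof -
  note ag = assms(1)
  define j where "j = a n"
  define p where "p = a j + a (j - 1)"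
  define q where "q = a (j + 1) + a j"
  have j3: "j \<ge> 3"
    using almost_golomb2_mono[OF ag assms(2)] almost_golomb2_start[OF ag] by (simp add: j_def)
  have pn: "p \<le> n" and nq: "n < q"
    using almost_golomb2_block[OF ag, of n] j3 by (simp_all add: j_def p_def q_def)
  have ap: "a p = j" using almost_golomb2_eq[OF ag, of j] j3 by (simp add: p_def)
  have aq: "a q = j + 1" using almost_golomb2_eq[OF ag, of "j + 1"] by (simp add: q_def)
  have q2: "q \<le> p + 2"
    using almost_golomb2_step[OF ag, of j] almost_golomb2_step[OF ag, of "j - 1"] j3
    by (simp add: p_def q_def)
  have p0: "p \<noteq> 0" using ap j3 almost_golomb2_start(1)[OF ag] by (intro notI) simp
  have le: "a (j + 1) \<le> n + 1" using almost_golomb2_le_Suc[OF ag, of n] by (simp add: j_def)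
  show ?thesis
  proof (cases "n + 1 = q")
    case True
    then have "n + 1 - a (j + 1) + a (j - 1) = p" by (simp add: p_def q_def)
    then show ?thesis using True ap aq by (simp add: j_def)
  next
    case False
    then have np: "n = p" and qp: "q = p + 2" using pn nq q2 by auto
    \<comment> \<open>A block of length two starts at \<open>n\<close>, so \<open>n + 1\<close> still belongs to it.\<close>
    have "a (n + 1) = j"
    proof (rule antisym)
      show "a (n + 1) \<le> j"
      proof (rule ccontr)
        assume "\<not> ?thesis"
        then have "a (n + 1) = j + 1" using almost_golomb2_step[OF ag, of n] by (simp add: j_def)
        then show False
          using almost_golomb2_block(1)[OF ag, of "n + 1"] j3 qp np by (simp add: q_def)
      qed
      show "j \<le> a (n + 1)" using almost_golomb2_mono[OF ag, of n "n + 1"] by (simp add: j_def)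
    qed
    moreover have "a (p - 1) = j - 1"
      using almost_golomb2_first[OF ag j3] almost_golomb2_step[OF ag, of "p - 1"] ap p0
      by (simp add: p_def)
    moreover have "n + 1 - a (j + 1) + a (j - 1) = p - 1"
      using np qp le by (simp add: p_def q_def)
    ultimately show ?thesis using j3 by (simp add: j_def)
  qed
qed

end
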